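(* Let $\rho:[0,1]\to[0,\infty)$ be a probability density function on $[0,1]$ with $\int_0^1\rho^2(p)\,dp<\infty$, and set $\lambda=\int_0^1\rho^2(p)\,dp$. Consider the optimization problem $$\max_{g}\ \left(\int_0^1 g(p)\rho(p)\,dp\right)^2-\lambda\int_0^1 g^2(p)\,dp\quad\text{subject to}\quad \int_0^1 g(p)\,dp=1,\ g(p)\ge 0,$$ over square-integrable functions $g$ on $[0,1]$. Then the optimal solution of this problem is $g=\rho$ (unique up to equality almost everywhere).
   Context: Functions on $[0,1]$ are measurable and identified when equal almost everywhere. In the paper, $\rho$ is the underlying probability density function of the p-values and $g(p)-1$ is the betting function used to build an additive martingale. *)

theory Defs
  imports "HOL-Analysis.Analysis"
begin

abbreviation unit_interval_measure :: "real measure" where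
  "unit_interval_measure \<equiv> lebesgue_on {0..1}"

definition square_integrable01 :: "(real \<Rightarrow> real) \<Rightarrow> bool" where
  "square_integrable01 f \<longleftrightarrow>
     f \<in> borel_measurable unit_interval_measure \<and>
     integrable unit_interval_measure (\<lambda>p. (f p)\<^sup>2)"

definition prob_density01 :: "(real \<Rightarrow> real) \<Rightarrow> bool" where
  "prob_density01 \<rho> \<longleftrightarrow>
     (\<forall>p\<in>{0..1}. 0 \<le> \<rho> p) \<and>
     integrable unit_interval_measure \<rho> \<and>
     (LINT p|unit_interval_measure. \<rho> p) = 1"

text \<open>Functions on the unit interval are identified when equal almost everywhere, so the sign
  constraint is imposed almost everywhere.\<close>

definition feasible :: "(real \<Rightarrow> real) \<Rightarrow> bool" where
  "feasible g \<longleftrightarrow>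
     square_integrable01 g \<and>
     (LINT p|unit_interval_measure. g p) = 1 \<and>
     (AE p in unit_interval_measure. 0 \<le> g p)"

definition objective :: "real \<Rightarrow> (real \<Rightarrow> real) \<Rightarrow> (real \<Rightarrow> real) \<Rightarrow> real" where
  "objective lam \<rho> g =
     (LINT p|unit_interval_measure. g p * \<rho> p)\<^sup>2
     - lam * (LINT p|unit_interval_measure. (g p)\<^sup>2)"

end

(* Write c for the integral of g * rho.  Expanding the square shows that the integral of
   (c * rho - lam * g)^2 equals - lam times the objective at g.  As lam > 0, the objective is
   nonpositive, and it vanishes at rho; when it vanishes at g, then lam * g = c * rho almost
   everywhere, and integrating this relation gives c = lam, because both functions have
   integral one. *)

theory Submission imports Defs begin

text \<open>The product is dominated by the sum of the squares, because 2 |a b| \<le> a^2 + b^2.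
  Hence the pairing of \<open>g\<close> with \<open>\<rho>\<close> is a genuine integral and not the
  default value 0.\<close>

lemma integrable_mult_of_squares:
  fixes f g :: "'a \<Rightarrow> real"
  assumes [measurable]: "f \<in> borel_measurable M" "g \<in> borel_measurable M"
    and "integrable M (\<lambda>x. (f x)\<^sup>2)" "integrable M (\<lambda>x. (g x)\<^sup>2)"
  shows "integrable M (\<lambda>x. f x * g x)"
proof (rule Bochner_Integration.integrable_bound)
  show "integrable M (\<lambda>x. (f x)\<^sup>2 + (g x)\<^sup>2)"
    using assms by simp
  have "\<bar>a * b\<bar> \<le> \<bar>a\<^sup>2 + b\<^sup>2\<bar>" for a b :: real
  proof -
    have "2 * (\<bar>a\<bar> * \<bar>b\<bar>) \<le> a\<^sup>2 + b\<^sup>2"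
      using sum_squares_bound[of "\<bar>a\<bar>" "\<bar>b\<bar>"] by simp
    moreover have "0 \<le> \<bar>a\<bar> * \<bar>b\<bar>" by simp
    ultimately show ?thesis unfolding abs_mult by linarith
  qed
  then show "AE x in M. norm (f x * g x) \<le> norm ((f x)\<^sup>2 + (g x)\<^sup>2)"
    by (simp only: real_norm_def) simp
qed measurable

text \<open>All three terms of the expanded square are integrable, so the integral splits. The cross
  term is written \<open>g x * f x\<close> to match the pairing in \<open>objective\<close> once
  \<open>f\<close> is \<open>\<rho>\<close>.\<close>

lemma integral_square_linear_combination:
  fixes f g :: "'a \<Rightarrow> real"
  assumes "f \<in> borel_measurable M" "g \<in> borel_measurable M"
    and f2: "integrable M (\<lambda>x. (f x)\<^sup>2)" and g2: "integrable M (\<lambda>x. (g x)\<^sup>2)"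
  shows "integrable M (\<lambda>x. (a * f x - b * g x)\<^sup>2)"
    and "(LINT x|M. (a * f x - b * g x)\<^sup>2) =
      a\<^sup>2 * (LINT x|M. (f x)\<^sup>2) - 2 * a * b * (LINT x|M. g x * f x) + b\<^sup>2 * (LINT x|M. (g x)\<^sup>2)"
proof -
  have gf: "integrable M (\<lambda>x. g x * f x)"
    using assms by (intro integrable_mult_of_squares)
  have expand: "(\<lambda>x. (a * f x - b * g x)\<^sup>2) =
      (\<lambda>x. a\<^sup>2 * (f x)\<^sup>2 - 2 * a * b * (g x * f x) + b\<^sup>2 * (g x)\<^sup>2)"
    by (simp add: fun_eq_iff power2_eq_square algebra_simps)
  show "integrable M (\<lambda>x. (a * f x - b * g x)\<^sup>2)"
    unfolding expand using f2 g2 gf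
    by (intro Bochner_Integration.integrable_add Bochner_Integration.integrable_diff
        integrable_mult_right)
  show "(LINT x|M. (a * f x - b * g x)\<^sup>2) =
      a\<^sup>2 * (LINT x|M. (f x)\<^sup>2) - 2 * a * b * (LINT x|M. g x * f x) + b\<^sup>2 * (LINT x|M. (g x)\<^sup>2)"
    unfolding expand using f2 g2 gf by simp
qed

theorem mainTheorem1:
  fixes \<rho> :: "real \<Rightarrow> real" and lam :: real
  assumes "prob_density01 \<rho>"
    and "integrable unit_interval_measure (\<lambda>p. (\<rho> p)\<^sup>2)"
    and "lam = (LINT p|unit_interval_measure. (\<rho> p)\<^sup>2)"
  shows "is_arg_max (objective lam \<rho>) feasible \<rho> \<and>
    (\<forall>g. is_arg_max (objective lam \<rho>) feasible g \<longrightarrow>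
         (AE p in unit_interval_measure. g p = \<rho> p))"
proof -
  let ?M = unit_interval_measure
  have \<rho>_nonneg: "\<forall>p\<in>{0..1}. 0 \<le> \<rho> p" and \<rho>_int: "integrable ?M \<rho>"
    and \<rho>_one: "(LINT p|?M. \<rho> p) = 1"
    using assms(1) by (auto simp: prob_density01_def)
  have \<rho>_meas: "\<rho> \<in> borel_measurable ?M"
    using \<rho>_int by (rule borel_measurable_integrable)
  have \<rho>_feasible: "feasible \<rho>"
    using \<rho>_meas assms(2) \<rho>_one \<rho>_nonneg
    by (auto simp: feasible_def square_integrable01_def intro!: AE_I2)
  \<comment> \<open>If the integral of the square vanished, \<open>\<rho>\<close> would be zero
    almost everywhere and could not have integral one.\<close>
  have lam_nonzero: "lam \<noteq> 0"
  proof
    assume "lam = 0"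
    then have "AE p in ?M. (\<rho> p)\<^sup>2 = 0"
      using integral_nonneg_eq_0_iff_AE[OF assms(2)] assms(3) by simp
    then have "AE p in ?M. \<rho> p = 0" by simp
    then have "(LINT p|?M. \<rho> p) = 0" by (rule integral_eq_zero_AE)
    then show False using \<rho>_one by simp
  qed
  moreover have "0 \<le> lam" unfolding assms(3) by simp
  ultimately have lam_pos: "0 < lam" by simp
  \<comment> \<open>At \<open>\<rho>\<close> both terms of the objective equal lam^2.\<close>
  have objective_\<rho>: "objective lam \<rho> \<rho> = 0"
    by (simp add: objective_def assms(3) power2_eq_square)
  \<comment> \<open>Integrability is recorded next to the value: a Bochner integral is 0 by default
    when the integrand is not integrable, so a zero integral alone would not make the square vanish
    almost everywhere.\<close>
  have defect_integrable: "integrable ?M (\<lambda>p. ((LINT p|?M. g p * \<rho> p) * \<rho> p - lam * g p)\<^sup>2)"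
    and defect: "(LINT p|?M. ((LINT p|?M. g p * \<rho> p) * \<rho> p - lam * g p)\<^sup>2) =
      - lam * objective lam \<rho> g" if "feasible g" for g
  proof -
    have g: "g \<in> borel_measurable ?M" "integrable ?M (\<lambda>p. (g p)\<^sup>2)"
      using that by (auto simp: feasible_def square_integrable01_def)
    note square = integral_square_linear_combination[OF \<rho>_meas g(1) assms(2) g(2)]
    show "integrable ?M (\<lambda>p. ((LINT p|?M. g p * \<rho> p) * \<rho> p - lam * g p)\<^sup>2)"
      by (rule square(1))
    show "(LINT p|?M. ((LINT p|?M. g p * \<rho> p) * \<rho> p - lam * g p)\<^sup>2) =
      - lam * objective lam \<rho> g"
      \<comment> \<open>With c the integral of \<open>g p * \<rho> p\<close>, the first two terms of
        the expansion are c^2 lam - 2 c^2 lam = - lam c^2, precisely because lam is the integral of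
        the square of \<open>\<rho>\<close>.\<close>
      unfolding square(2) objective_def assms(3)[symmetric]
      by (simp add: power2_eq_square algebra_simps)
  qed
  have objective_le: "objective lam \<rho> g \<le> 0" if "feasible g" for g
  proof -
    have "0 \<le> (LINT p|?M. ((LINT p|?M. g p * \<rho> p) * \<rho> p - lam * g p)\<^sup>2)" by simp
    then have "lam * objective lam \<rho> g \<le> 0" unfolding defect[OF that] by simp
    then show ?thesis using lam_pos by (simp add: mult_le_0_iff)
  qed
  have "AE p in ?M. g p = \<rho> p" if "is_arg_max (objective lam \<rho>) feasible g" for g
  proof -
    define c where "c = (LINT p|?M. g p * \<rho> p)"
    \<comment> \<open>The feasible \<open>\<rho>\<close> serves as competitor: a maximizer has value
      at least 0, and the upper bound then forces equality.\<close>
    have feas: "feasible g" and "\<not> objective lam \<rho> g < objective lam \<rho> \<rho>"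
      using that \<rho>_feasible by (auto simp: is_arg_max_def)
    then have "objective lam \<rho> g = 0"
      using objective_le[OF feas] objective_\<rho> by simp
    then have "(LINT p|?M. (c * \<rho> p - lam * g p)\<^sup>2) = 0"
      using defect[OF feas] by (simp add: c_def)
    then have "AE p in ?M. (c * \<rho> p - lam * g p)\<^sup>2 = 0"
      using integral_nonneg_eq_0_iff_AE[OF defect_integrable[OF feas]] by (simp add: c_def)
    then have proportional: "AE p in ?M. g p = c / lam * \<rho> p"
      by eventually_elim (use lam_nonzero in \<open>simp add: field_simps\<close>)
    \<comment> \<open>The normalization of \<open>g\<close> and of \<open>\<rho>\<close> fixes the
      factor of proportionality to be 1.\<close>
    have "1 = (LINT p|?M. g p)" using feas by (simp add: feasible_def)
    also have "\<dots> = (LINT p|?M. c / lam * \<rho> p)"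
      using feas \<rho>_meas proportional
      by (intro integral_cong_AE) (auto simp: feasible_def square_integrable01_def)
    also have "\<dots> = c / lam" using \<rho>_one by simp
    finally show ?thesis using proportional by simp
  qed
  moreover have "is_arg_max (objective lam \<rho>) feasible \<rho>"
    using \<rho>_feasible objective_le objective_\<rho> by (auto simp: is_arg_max_def not_less)
  ultimately show ?thesis by blast
qed

end
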